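(* Let $(L_n)_{n\in\mathbb Z}$ be a sequence of Markov operators on $(B_s,\|\cdot\|_s)\subset(B_w,\|\cdot\|_w)$, let $(\pi_m)_{m\ge1}$ be projections on $B_w$ which preserve total mass and satisfy, for every $m$, $\|\pi_mf\|_w\le\|f\|_w$ for $f\in B_w$, $\|\pi_mf\|_s\le\|f\|_s$ for $f\in B_s$, and $\|\pi_mf-f\|_w\le\delta_m\|f\|_s$ for $f\in B_s$, where $\delta_m\to0$. Put $M_n^{(m)}:=\pi_mL_n\pi_m$. Assume there are constants $B\ge1$ and $\lambda_1\in[0,1)$ such that for every $n\in\mathbb Z$, $m\ge1$ and $f\in B_s$, $$\|L_nf\|_s\le\lambda_1\|f\|_s+B\|f\|_w,\qquad \|M_n^{(m)}f\|_s\le\lambda_1\|f\|_s+B\|f\|_w,$$ and that $\|L_nf\|_w\le\|f\|_w$ and $\|M_n^{(m)}f\|_w\le\|f\|_w$ for all $n$, $m$ and $f\in B_w$. Suppose there is an integer $M\ge1$ such that $$\lambda_1^M\le\frac{1}{10\left(\frac{B}{1-\lambda_1}+1\right)}$$ and $$\|L^{(j,j+M-1)}v\|_w\le\frac{1-\lambda_1}{10B}\|v\|_s\qquad\forall j\in\mathbb Z,\ \forall v\in V_s.$$ If $m$ is such that $$\varepsilon_m:=\sup_{n\in\mathbb Z}\|M_n^{(m)}-L_n\|_{B_s\to B_w}\le\frac{7(1-\lambda_1)^2}{10MB\left(\frac1{1-\lambda_1}+B\right)},\qquad( * )$$ then for every $j\in\mathbb Z$ and every $g\in V_s$, $$\|M^{(m),(j,j+2M-1)}g\|_s\le\frac9{10}\|g\|_s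 .$$ In particular, there exist $C>0$ and $\rho\in(0,1)$, independent of $m$, such that for each $m$ satisfying $( * )$, $$\|M^{(m),(j,j+n-1)}g\|_s\le C\rho^n\|g\|_s\qquad\forall j\in\mathbb Z,\ \forall n\ge1,\ \forall g\in V_s .$$
   Context: $(X,\mathcal A)$ is a measurable space; $B_s\subset B_w$ are normed linear spaces of finite signed measures on $X$, with $\|\mu\|_w\le\|\mu\|_s$ for all $\mu\in B_s$. $V_s:=\{\mu\in B_s:\mu(X)=0\}$. A Markov operator is a linear map $B_w\to B_w$ that maps $B_s$ into $B_s$, preserves positivity and preserves total mass $\mu\mapsto\mu(X)$. A projection is a linear map $\pi$ with $\pi^2=\pi$; $\pi_m$ maps $B_s$ into $B_s$, and preserving total mass means $(\pi_mf)(X)=f(X)$. For $j\in\mathbb Z$, $n\ge1$: $L^{(j,j+n-1)}:=L_{j+n-1}\circ\cdots\circ L_j$ and $M^{(m),(j,j+n-1)}:=M^{(m)}_{j+n-1}\circ\cdots\circ M^{(m)}_j$. $\|A\|_{B_s\to B_w}:=\sup\{\|Af\|_w:f\in B_s,\ \|f\|_s\le1\}$. *)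

theory Defs
  imports "HOL-Analysis.Analysis" "HOL-Library.Function_Algebras"
begin

instantiation "fun" :: (type, real_vector) real_vector
begin

definition scaleR_fun :: "real \<Rightarrow> ('a \<Rightarrow> 'b) \<Rightarrow> 'a \<Rightarrow> 'b"
  where "scaleR_fun c f = (\<lambda>x. c *\<^sub>R f x)"

instance
  by standard (auto simp: scaleR_fun_def fun_eq_iff scaleR_add_right scaleR_add_left)

end

(* Only the measurable space underlying X (space X, sets X) is used, never its measure.
   Signed measures are set functions with the pointwise vector space structure; the value 0
   outside the sigma-algebra makes equality of functions coincide with equality of measures. *)
definition finite_signed_measure :: "'a measure \<Rightarrow> ('a set \<Rightarrow> real) \<Rightarrow> bool"
  where "finite_signed_measure X \<mu> \<longleftrightarrow>
    \<mu> {} = 0 \<and>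
    (\<forall>A :: nat \<Rightarrow> 'a set. range A \<subseteq> sets X \<and> disjoint_family A \<longrightarrow>
       (\<lambda>i. \<mu> (A i)) sums \<mu> (\<Union>i. A i)) \<and>
    (\<forall>A. A \<notin> sets X \<longrightarrow> \<mu> A = 0)"

definition norm_on :: "'v::real_vector set \<Rightarrow> ('v \<Rightarrow> real) \<Rightarrow> bool"
  where "norm_on V N \<longleftrightarrow>
    (\<forall>x\<in>V. 0 \<le> N x \<and> (N x = 0 \<longleftrightarrow> x = 0)) \<and>
    (\<forall>x\<in>V. \<forall>y\<in>V. N (x + y) \<le> N x + N y) \<and>
    (\<forall>c. \<forall>x\<in>V. N (c *\<^sub>R x) = \<bar>c\<bar> * N x)"

definition normed_signed_measures ::
    "'a measure \<Rightarrow> ('a set \<Rightarrow> real) set \<Rightarrow> (('a set \<Rightarrow> real) \<Rightarrow> real) \<Rightarrow> bool"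
  where "normed_signed_measures X V N \<longleftrightarrow>
    (\<forall>\<mu>\<in>V. finite_signed_measure X \<mu>) \<and> subspace V \<and> norm_on V N"

definition zero_mass :: "'a measure \<Rightarrow> ('a set \<Rightarrow> real) set \<Rightarrow> ('a set \<Rightarrow> real) set"
  where "zero_mass X V = {\<mu> \<in> V. \<mu> (space X) = 0}"

definition endo_on :: "'v::real_vector set \<Rightarrow> ('v \<Rightarrow> 'v) \<Rightarrow> bool"
  where "endo_on V T \<longleftrightarrow>
    (\<forall>x\<in>V. T x \<in> V) \<and>
    (\<forall>x\<in>V. \<forall>y\<in>V. T (x + y) = T x + T y) \<and>
    (\<forall>c. \<forall>x\<in>V. T (c *\<^sub>R x) = c *\<^sub>R T x)"

definition preserves_mass ::
    "'a measure \<Rightarrow> ('a set \<Rightarrow> real) set \<Rightarrow> (('a set \<Rightarrow> real) \<Rightarrow> 'a set \<Rightarrow> real) \<Rightarrow> bool"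
  where "preserves_mass X V T \<longleftrightarrow> (\<forall>\<mu>\<in>V. T \<mu> (space X) = \<mu> (space X))"

definition preserves_positivity ::
    "'a measure \<Rightarrow> ('a set \<Rightarrow> real) set \<Rightarrow> (('a set \<Rightarrow> real) \<Rightarrow> 'a set \<Rightarrow> real) \<Rightarrow> bool"
  where "preserves_positivity X V T \<longleftrightarrow>
    (\<forall>\<mu>\<in>V. (\<forall>A\<in>sets X. 0 \<le> \<mu> A) \<longrightarrow> (\<forall>A\<in>sets X. 0 \<le> T \<mu> A))"

definition markov_operator ::
    "'a measure \<Rightarrow> ('a set \<Rightarrow> real) set \<Rightarrow> ('a set \<Rightarrow> real) set \<Rightarrow>
      (('a set \<Rightarrow> real) \<Rightarrow> 'a set \<Rightarrow> real) \<Rightarrow> bool"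
  where "markov_operator X Bs Bw T \<longleftrightarrow>
    endo_on Bw T \<and> (\<forall>\<mu>\<in>Bs. T \<mu> \<in> Bs) \<and>
    preserves_positivity X Bw T \<and> preserves_mass X Bw T"

definition projection_on :: "'v::real_vector set \<Rightarrow> ('v \<Rightarrow> 'v) \<Rightarrow> bool"
  where "projection_on V P \<longleftrightarrow> endo_on V P \<and> (\<forall>x\<in>V. P (P x) = P x)"

(* L k o ... o L j; the identity if k < j *)
definition seq_comp :: "(int \<Rightarrow> 'v \<Rightarrow> 'v) \<Rightarrow> int \<Rightarrow> int \<Rightarrow> 'v \<Rightarrow> 'v"
  where "seq_comp L j k = fold L [j..k]"

(* ereal-valued, so that an unbounded operator has norm \<infinity> *)
definition op_norm ::
    "'v set \<Rightarrow> ('v \<Rightarrow> real) \<Rightarrow> ('v \<Rightarrow> real) \<Rightarrow> ('v \<Rightarrow> 'v) \<Rightarrow> ereal"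
  where "op_norm V N N' A = (SUP f\<in>{f\<in>V. N f \<le> 1}. ereal (N' (A f)))"

end

theory Submission
  imports Defs
begin

text \<open>
  Iterating the Lasota--Yorke inequality bounds the strong norm of the twofold block
  $M^{(m),(j,j+2M-1)} g$ by $\lambda_1^M$ times the strong norm, plus $B/(1-\lambda_1)$ times the
  weak norm, of the half block $M^{(m),(j,j+M-1)} g$. The first term contributes $1/10$. For the
  second, replace the half block by that of $L$, which contributes another $1/10$; the telescoping
  error has $M$ terms, each at most $\varepsilon_m$ times the strong norm of some $L^{(j,k)} g$,
  and contributes $7/10$. Exponential decay follows by splitting $n$ into blocks of length $2M$.
\<close>

section \<open>Compositions over a window of integer times\<close>

lemma seq_comp_0 [simp]: "seq_comp T j (j - 1) x = x"
  by (simp add: seq_comp_def)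

text \<open>Windows end at \<open>j + int n - 1\<close>, so that \<open>n\<close> counts the factors
  and \<open>n = 0\<close> gives the identity, the base case of the inductions below. The interval
  is split at its right end because \<open>fold\<close> applies the latest operator last.\<close>

lemma seq_comp_Suc:
  "seq_comp T j (j + int (Suc n) - 1) x = T (j + int n) (seq_comp T j (j + int n - 1) x)"
  using upto_rec2[of j "j + int n"] by (simp add: seq_comp_def)

text \<open>Cocycle law of a nonautonomous composition: the second block starts at the shifted time
  \<open>j + int m\<close>, so estimates on blocks can be chained once they are uniform in the
  starting time.\<close>

lemma seq_comp_add:
  "seq_comp T j (j + int (m + n) - 1) x =
    seq_comp T (j + int m) (j + int m + int n - 1) (seq_comp T j (j + int m - 1) x)"
proof (induction n)
  case 0
  show ?case
    by simp
next
  case (Suc n)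
  have "seq_comp T j (j + int (m + Suc n) - 1) x =
      T (j + int (m + n)) (seq_comp T j (j + int (m + n) - 1) x)"
    using seq_comp_Suc[of T j "m + n"] by simp
  then show ?case
    using Suc seq_comp_Suc[of T "j + int m" n] by (simp add: add.assoc)
qed

lemma seq_comp_invariant:
  assumes "\<And>n x. x \<in> V \<Longrightarrow> T n x \<in> V" and "x \<in> V"
  shows "seq_comp T j (j + int n - 1) x \<in> V"
  by (induction n) (use assms in \<open>simp_all add: seq_comp_Suc del: of_nat_Suc\<close>)

lemma seq_comp_contraction:
  fixes N :: "'v \<Rightarrow> real"
  assumes "\<And>n x. x \<in> V \<Longrightarrow> T n x \<in> V" and "\<And>n x. x \<in> V \<Longrightarrow> N (T n x) \<le> N x" and "x \<in> V"
  shows "N (seq_comp T j (j + int n - 1) x) \<le> N x"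
proof (induction n)
  case (Suc n)
  have "seq_comp T j (j + int n - 1) x \<in> V"
    using assms(1,3) by (rule seq_comp_invariant)
  then show ?case
    unfolding seq_comp_Suc using assms(2) Suc order_trans by blast
qed simp

text \<open>Weak norms do not grow along the orbit, so every step adds at most
  \<open>B * nw x\<close>. The constant \<open>B / (1 - a)\<close> is the sum of the resulting
  geometric series, equivalently the fixed point of \<open>t = a * t + B\<close>, which closes the
  induction.\<close>

lemma seq_comp_Lasota_Yorke:
  fixes ns nw :: "'v \<Rightarrow> real"
  assumes inv: "\<And>n x. x \<in> V \<Longrightarrow> T n x \<in> V"
    and weak: "\<And>n x. x \<in> V \<Longrightarrow> nw (T n x) \<le> nw x"
    and LY: "\<And>n x. x \<in> V \<Longrightarrow> ns (T n x) \<le> a * ns x + B * nw x"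
    and "0 \<le> a" "a < 1" "0 \<le> B" "0 \<le> nw x" "x \<in> V"
  shows "ns (seq_comp T j (j + int n - 1) x) \<le> a ^ n * ns x + B / (1 - a) * nw x"
proof (induction n)
  case 0
  have "0 \<le> B / (1 - a) * nw x"
    using assms by simp
  then show ?case
    by simp
next
  case (Suc n)
  let ?y = "seq_comp T j (j + int n - 1) x"
  have y: "?y \<in> V"
    using inv \<open>x \<in> V\<close> by (rule seq_comp_invariant)
  have wy: "nw ?y \<le> nw x"
    using inv weak \<open>x \<in> V\<close> by (rule seq_comp_contraction)
  have "ns (T (j + int n) ?y) \<le> a * ns ?y + B * nw ?y"
    using LY y .
  also have "\<dots> \<le> a * (a ^ n * ns x + B / (1 - a) * nw x) + B * nw x"
    using Suc wy assms by (intro add_mono mult_left_mono) auto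
  also have "\<dots> = a ^ Suc n * ns x + B / (1 - a) * nw x"
    using \<open>a < 1\<close> by (simp add: field_simps)
  finally show ?case
    unfolding seq_comp_Suc .
qed

section \<open>Comparison of two operator sequences in the mixed norm\<close>

lemma endo_on_diff:
  assumes "endo_on V T" "subspace V" "x \<in> V" "y \<in> V"
  shows "T (x - y) = T x - T y"
proof -
  have "x - y \<in> V"
    using assms by (simp add: subspace_diff)
  then have "T (x - y + y) = T (x - y) + T y"
    using assms unfolding endo_on_def by blast
  then show ?thesis
    by (simp add: eq_diff_eq)
qed

text \<open>One telescoping step is \<open>S s - T t = S (s - t) + (S t - T t)\<close>. The weak
  contraction \<open>S\<close> carries the old error along without enlarging it, and the new error
  is controlled by the strong norm along the \<open>T\<close>-orbit alone. Hence the growth is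
  linear in \<open>n\<close>.\<close>

lemma seq_comp_perturbation:
  fixes ns nw :: "'v::real_vector \<Rightarrow> real"
  assumes "subspace W" and nw: "norm_on W nw" and "V \<subseteq> W"
    and endoS: "\<And>n. endo_on W (S n)" and endoT: "\<And>n. endo_on W (T n)"
    and inv: "\<And>n x. x \<in> V \<Longrightarrow> T n x \<in> V"
    and weak: "\<And>n x. x \<in> W \<Longrightarrow> nw (S n x) \<le> nw x"
    and near: "\<And>n x. x \<in> V \<Longrightarrow> nw (S n x - T n x) \<le> e * ns x"
    and bound: "\<And>n. ns (seq_comp T j (j + int n - 1) x) \<le> K"
    and "0 \<le> e" "x \<in> V"
  shows "nw (seq_comp S j (j + int n - 1) x - seq_comp T j (j + int n - 1) x) \<le> real n * (e * K)"
proof (induction n)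
  case 0
  have "nw 0 = 0"
    using nw subspace_0[OF \<open>subspace W\<close>] by (auto simp: norm_on_def)
  then show ?case
    by simp
next
  case (Suc n)
  let ?k = "j + int n"
  let ?s = "seq_comp S j (?k - 1) x" and ?t = "seq_comp T j (?k - 1) x"
  have t: "?t \<in> V"
    using inv \<open>x \<in> V\<close> by (rule seq_comp_invariant)
  have S_W: "S n y \<in> W" if "y \<in> W" for n y
    using endoS that by (auto simp: endo_on_def)
  have T_W: "T n y \<in> W" if "y \<in> W" for n y
    using endoT that by (auto simp: endo_on_def)
  have s: "?s \<in> W" and tW: "?t \<in> W"
    using S_W \<open>x \<in> V\<close> t \<open>V \<subseteq> W\<close> by (auto intro: seq_comp_invariant)
  have d: "?s - ?t \<in> W"
    using s tW \<open>subspace W\<close> by (rule subspace_diff[rotated])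
  have r: "S ?k ?t - T ?k ?t \<in> W"
    using S_W T_W tW \<open>subspace W\<close> by (simp add: subspace_diff)
  have "S ?k ?s - T ?k ?t = S ?k (?s - ?t) + (S ?k ?t - T ?k ?t)"
    using endo_on_diff[OF endoS \<open>subspace W\<close> s tW] by simp
  then have "nw (S ?k ?s - T ?k ?t) \<le> nw (S ?k (?s - ?t)) + nw (S ?k ?t - T ?k ?t)"
    using nw S_W[OF d] r unfolding norm_on_def by metis
  also have "\<dots> \<le> real n * (e * K) + e * K"
  proof (rule add_mono)
    show "nw (S ?k (?s - ?t)) \<le> real n * (e * K)"
      using weak[OF d] Suc by (rule order_trans)
    show "nw (S ?k ?t - T ?k ?t) \<le> e * K"
      using near[OF t] mult_left_mono[OF bound \<open>0 \<le> e\<close>] by (rule order_trans)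
  qed
  finally show ?case
    unfolding seq_comp_Suc by (simp add: algebra_simps)
qed

text \<open>Homogeneity extends the supremum over the unit ball to all of \<open>V\<close> by
  rescaling \<open>x\<close> to strong norm 1. The zero vector cannot be rescaled, but there both
  sides vanish.\<close>

lemma op_norm_le_imp_bound:
  fixes ns nw :: "'v::real_vector \<Rightarrow> real"
  assumes "subspace V" "norm_on V ns" "norm_on W nw"
    and "\<And>x. x \<in> V \<Longrightarrow> A x \<in> W"
    and hom: "\<And>c x. x \<in> V \<Longrightarrow> A (c *\<^sub>R x) = c *\<^sub>R A x"
    and le: "op_norm V ns nw A \<le> ereal e" and "x \<in> V"
  shows "nw (A x) \<le> e * ns x"
proof (cases "x = 0")
  case True
  have "A (0 *\<^sub>R x) = 0 *\<^sub>R A x"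
    using hom \<open>x \<in> V\<close> by blast
  then have "A 0 = 0" and "0 \<in> W"
    using True assms(4) \<open>x \<in> V\<close> by force+
  then have "nw (A x) = 0" "ns x = 0"
    using True assms(2,3) \<open>x \<in> V\<close> by (auto simp: norm_on_def)
  then show ?thesis
    by simp
next
  case False
  then have pos: "0 < ns x"
    using assms(2) \<open>x \<in> V\<close> unfolding norm_on_def by (metis order_le_less)
  define y where "y = inverse (ns x) *\<^sub>R x"
  have y: "y \<in> V"
    using assms(1) \<open>x \<in> V\<close> by (simp add: y_def subspace_scale)
  have "ns y = 1"
    using assms(2) \<open>x \<in> V\<close> pos False by (simp add: y_def norm_on_def)
  then have "ereal (nw (A y)) \<le> op_norm V ns nw A"
    unfolding op_norm_def using y by (intro SUP_upper) simp
  then have "nw (A y) \<le> e"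
    using le order_trans ereal_less_eq(3) by blast
  moreover have "nw (A y) = inverse (ns x) * nw (A x)"
    using assms(3,4) hom \<open>x \<in> V\<close> pos by (simp add: y_def norm_on_def)
  ultimately show ?thesis
    using pos by (simp add: field_simps)
qed

section \<open>From contraction over blocks to exponential decay\<close>

lemma seq_comp_block_decay:
  fixes N :: "'v \<Rightarrow> real"
  assumes inv: "\<And>n x. x \<in> V \<Longrightarrow> T n x \<in> V"
    and block: "\<And>j x. x \<in> V \<Longrightarrow> N (seq_comp T j (j + int p - 1) x) \<le> c * N x"
    and bound: "\<And>j n x. x \<in> V \<Longrightarrow> N (seq_comp T j (j + int n - 1) x) \<le> K * N x"
    and nonneg: "\<And>x. x \<in> V \<Longrightarrow> 0 \<le> N x"
    and c: "0 < c" "c < 1" and "1 \<le> p" "0 \<le> K" and x: "x \<in> V"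
  shows "N (seq_comp T j (j + int n - 1) x) \<le> K / c * root p c ^ n * N x"
proof -
  have blocks: "N (seq_comp T j (j + int (q * p) - 1) x) \<le> c ^ q * N x" for q
  proof (induction q)
    case 0
    show ?case
      by simp
  next
    case (Suc q)
    let ?y = "seq_comp T j (j + int (q * p) - 1) x"
    have y: "?y \<in> V"
      using inv x by (rule seq_comp_invariant)
    have "N (seq_comp T j (j + int (q * p + p) - 1) x) \<le> c * N ?y"
      unfolding seq_comp_add using y by (rule block)
    also have "\<dots> \<le> c * (c ^ q * N x)"
      using Suc c by (intro mult_left_mono) auto
    finally show ?case
      by (simp add: algebra_simps)
  qed
  \<comment> \<open>The first \<open>q * p\<close> factors form full blocks and gain
    \<open>c ^ q\<close>; the remaining \<open>n mod p\<close> factors, applied last, cost at most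
    \<open>K\<close>.\<close>
  define q where "q = n div p"
  let ?y = "seq_comp T j (j + int (q * p) - 1) x"
  have n: "n = q * p + n mod p"
    by (simp add: q_def)
  have y: "?y \<in> V"
    using inv x by (rule seq_comp_invariant)
  have "N (seq_comp T j (j + int n - 1) x) \<le> K * N ?y"
    by (subst n, unfold seq_comp_add) (rule bound[OF y])
  also have "\<dots> \<le> K * (c ^ q * N x)"
    using blocks \<open>0 \<le> K\<close> by (intro mult_left_mono)
  also have "\<dots> \<le> K * (root p c ^ n / c * N x)"
  proof (intro mult_left_mono mult_right_mono nonneg[OF x] \<open>0 \<le> K\<close>)
    \<comment> \<open>With rate \<open>root p c\<close>, whose \<open>p\<close>-th power is
      \<open>c\<close>, one block more than \<open>q\<close> covers all \<open>n\<close> steps. The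
      division by \<open>c\<close> pays for that extra block.\<close>
    have "n \<le> p * Suc q"
      using n mod_less_divisor[of p n] \<open>1 \<le> p\<close> unfolding mult_Suc_right
      by (metis add.commute add_le_mono less_imp_le mult.commute le_refl less_eq_Suc_le One_nat_def)
    then have "root p c ^ (p * Suc q) \<le> root p c ^ n"
      using c \<open>1 \<le> p\<close> by (intro power_decreasing) auto
    moreover have "root p c ^ (p * Suc q) = c ^ Suc q"
      using c \<open>1 \<le> p\<close> by (simp only: power_mult) simp
    ultimately show "c ^ q \<le> root p c ^ n / c"
      using c by (simp add: field_simps)
  qed
  finally show ?thesis
    by (simp add: mult_ac)
qed

section \<open>Contraction and decay of the projected operators\<close>

theorem proposition19:
  fixes X :: "'a measure"
    and Bs Bw :: "('a set \<Rightarrow> real) set"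
    and ns nw :: "('a set \<Rightarrow> real) \<Rightarrow> real"
    and L :: "int \<Rightarrow> ('a set \<Rightarrow> real) \<Rightarrow> 'a set \<Rightarrow> real"
    and \<pi> :: "nat \<Rightarrow> ('a set \<Rightarrow> real) \<Rightarrow> 'a set \<Rightarrow> real"
    and Mop :: "nat \<Rightarrow> int \<Rightarrow> ('a set \<Rightarrow> real) \<Rightarrow> 'a set \<Rightarrow> real"
    and \<delta> :: "nat \<Rightarrow> real"
    and \<epsilon> :: "nat \<Rightarrow> ereal"
    and B lam1 :: real
    and M :: nat
  assumes strong_space: "normed_signed_measures X Bs ns"
    and weak_space: "normed_signed_measures X Bw nw"
    and "Bs \<subseteq> Bw"
    and "\<And>\<mu>. \<mu> \<in> Bs \<Longrightarrow> nw \<mu> \<le> ns \<mu>"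
    and L_markov: "\<And>n. markov_operator X Bs Bw (L n)"
    and \<pi>_proj: "\<And>m. m \<ge> 1 \<Longrightarrow> projection_on Bw (\<pi> m)"
    and \<pi>_Bs: "\<And>m f. m \<ge> 1 \<Longrightarrow> f \<in> Bs \<Longrightarrow> \<pi> m f \<in> Bs"
    and \<pi>_mass: "\<And>m. m \<ge> 1 \<Longrightarrow> preserves_mass X Bw (\<pi> m)"
    and \<pi>_weak: "\<And>m f. m \<ge> 1 \<Longrightarrow> f \<in> Bw \<Longrightarrow> nw (\<pi> m f) \<le> nw f"
    and \<pi>_strong: "\<And>m f. m \<ge> 1 \<Longrightarrow> f \<in> Bs \<Longrightarrow> ns (\<pi> m f) \<le> ns f"
    and \<pi>_approx: "\<And>m f. m \<ge> 1 \<Longrightarrow> f \<in> Bs \<Longrightarrow> nw (\<pi> m f - f) \<le> \<delta> m * ns f"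
    and \<delta>_lim: "\<delta> \<longlonglongrightarrow> 0"
    and Mop_def: "\<And>m n. Mop m n = \<pi> m \<circ> L n \<circ> \<pi> m"
    and B: "B \<ge> 1"
    and lam1: "0 \<le> lam1" "lam1 < 1"
    and L_LY: "\<And>n f. f \<in> Bs \<Longrightarrow> ns (L n f) \<le> lam1 * ns f + B * nw f"
    and Mop_LY: "\<And>m n f. m \<ge> 1 \<Longrightarrow> f \<in> Bs \<Longrightarrow> ns (Mop m n f) \<le> lam1 * ns f + B * nw f"
    and L_weak: "\<And>n f. f \<in> Bw \<Longrightarrow> nw (L n f) \<le> nw f"
    and Mop_weak: "\<And>m n f. m \<ge> 1 \<Longrightarrow> f \<in> Bw \<Longrightarrow> nw (Mop m n f) \<le> nw f"
    and M: "M \<ge> 1"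
    and M_lam1: "lam1 ^ M \<le> 1 / (10 * (B / (1 - lam1) + 1))"
    and M_L: "\<And>j v. v \<in> zero_mass X Bs \<Longrightarrow>
        nw (seq_comp L j (j + int M - 1) v) \<le> (1 - lam1) / (10 * B) * ns v"
    and \<epsilon>_def: "\<And>m. \<epsilon> m = (SUP n. op_norm Bs ns nw (\<lambda>f. Mop m n f - L n f))"
  shows "(\<forall>m\<ge>1. \<epsilon> m \<le> ereal (7 * (1 - lam1)\<^sup>2 / (10 * real M * B * (1 / (1 - lam1) + B))) \<longrightarrow>
            (\<forall>j. \<forall>g \<in> zero_mass X Bs.
               ns (seq_comp (Mop m) j (j + 2 * int M - 1) g) \<le> 9 / 10 * ns g)) \<and>
         (\<exists>C \<rho>. C > 0 \<and> 0 < \<rho> \<and> \<rho> < 1 \<and>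
            (\<forall>m\<ge>1. \<epsilon> m \<le> ereal (7 * (1 - lam1)\<^sup>2 / (10 * real M * B * (1 / (1 - lam1) + B))) \<longrightarrow>
               (\<forall>j. \<forall>n::nat. n \<ge> 1 \<longrightarrow> (\<forall>g \<in> zero_mass X Bs.
                  ns (seq_comp (Mop m) j (j + int n - 1) g) \<le> C * \<rho> ^ n * ns g))))"
proof -
  let ?a = "1 / (1 - lam1)"
  let ?e = "7 * (1 - lam1)\<^sup>2 / (10 * real M * B * (?a + B))"
  let ?K = "B * ?a + 1"
  let ?Z = "zero_mass X Bs"
  have subW: "subspace Bw" and nw: "norm_on Bw nw" and subS: "subspace Bs" and ns: "norm_on Bs ns"
    using strong_space weak_space by (auto simp: normed_signed_measures_def)
  note ZD = zero_mass_def[of X Bs]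
  have a: "1 \<le> ?a" and pos: "0 < 1 - lam1"
    using lam1 by (simp_all add: field_simps)
  have Ba: "0 \<le> B * ?a"
    using pos B by simp
  then have K: "0 < ?K"
    by (rule add_nonneg_pos) simp
  have nonneg_s: "0 \<le> ns f" if "f \<in> Bs" for f
    using ns that by (auto simp: norm_on_def)
  have nonneg_w: "0 \<le> nw f" if "f \<in> Bs" for f
    using nw that \<open>Bs \<subseteq> Bw\<close> by (auto simp: norm_on_def)
  have endo_L: "endo_on Bw (L n)" and L_Bs: "\<And>f. f \<in> Bs \<Longrightarrow> L n f \<in> Bs"
    and L_mass: "preserves_mass X Bw (L n)" for n
    using L_markov[of n] by (auto simp: markov_operator_def)
  have endo_M: "endo_on Bw (Mop m n)" if "m \<ge> 1" for m n
    using endo_L[of n] \<pi>_proj[OF that] unfolding Mop_def projection_on_def endo_on_def by simp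
  have M_Bs: "Mop m n f \<in> Bs" if "m \<ge> 1" "f \<in> Bs" for m n f
    using that \<pi>_Bs L_Bs by (simp add: Mop_def)
  \<comment> \<open>Iterating the block estimate requires zero mass to persist. All three factors of
    \<open>Mop m n\<close> preserve mass on \<open>Bw\<close>, where the intermediate measures
    lie.\<close>
  have M_Z: "Mop m n f \<in> ?Z" if "m \<ge> 1" "f \<in> ?Z" for m n f
  proof -
    have f: "f \<in> Bs" "f (space X) = 0"
      using that by (auto simp: ZD)
    have "\<pi> m f \<in> Bw" "L n (\<pi> m f) \<in> Bw" "f \<in> Bw"
      using f \<pi>_Bs L_Bs \<open>Bs \<subseteq> Bw\<close> that(1) by blast+
    then have "Mop m n f (space X) = 0"
      using f(2) \<pi>_mass[OF that(1)] L_mass[of n] by (simp add: Mop_def preserves_mass_def)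
    then show ?thesis
      using M_Bs that(1) f(1) by (simp add: ZD)
  qed
  \<comment> \<open>As \<open>nw\<close> is dominated by \<open>ns\<close> on \<open>Bs\<close>, the
    iterated inequality yields a strong bound independent of \<open>n\<close>; \<open>?K\<close> is
    also the quantity in the denominator of \<open>M_lam1\<close>.\<close>
  have LY_bound: "lam1 ^ n * ns f + B / (1 - lam1) * nw f \<le> ?K * ns f" if "f \<in> Bs" for n f
  proof -
    have "lam1 ^ n * ns f \<le> 1 * ns f"
      using that lam1 nonneg_s by (intro mult_right_mono power_le_one) auto
    moreover have "B / (1 - lam1) * nw f \<le> B / (1 - lam1) * ns f"
      using that assms(4) B pos by (intro mult_left_mono) auto
    ultimately show ?thesis
      by (simp add: algebra_simps)
  qed
  have L_bound: "ns (seq_comp L j (j + int n - 1) f) \<le> ?K * ns f" if "f \<in> Bs" for j n f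
  proof -
    have "ns (seq_comp L j (j + int n - 1) f) \<le> lam1 ^ n * ns f + B / (1 - lam1) * nw f"
      by (rule seq_comp_Lasota_Yorke[where V = Bs])
        (use that L_Bs L_weak L_LY lam1 B nonneg_w \<open>Bs \<subseteq> Bw\<close> in auto)
    also note LY_bound[OF that]
    finally show ?thesis .
  qed
  have M_LY: "ns (seq_comp (Mop m) j (j + int n - 1) f) \<le> lam1 ^ n * ns f + B / (1 - lam1) * nw f"
    if "m \<ge> 1" "f \<in> Bs" for m j n f
    by (rule seq_comp_Lasota_Yorke[where V = Bs])
      (use that M_Bs Mop_weak Mop_LY lam1 B nonneg_w \<open>Bs \<subseteq> Bw\<close> in auto)
  have M_bound: "ns (seq_comp (Mop m) j (j + int n - 1) f) \<le> ?K * ns f"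
    if "m \<ge> 1" "f \<in> Bs" for m j n f
    using M_LY[OF that] LY_bound[OF that(2)] by (rule order_trans)
  have block: "ns (seq_comp (Mop m) j (j + int (2 * M) - 1) g) \<le> 9 / 10 * ns g"
    if m: "m \<ge> 1" and eps: "\<epsilon> m \<le> ereal ?e" and g: "g \<in> ?Z" for m j g
  proof -
    have g_Bs: "g \<in> Bs" and g_nonneg: "0 \<le> ns g"
      using g nonneg_s by (auto simp: ZD)
    have "0 \<le> ?a + B"
      using B a by linarith
    then have e: "0 \<le> ?e"
      using B by (intro divide_nonneg_nonneg mult_nonneg_nonneg) auto
    \<comment> \<open>The supremum over \<open>n\<close> in \<open>\<epsilon> m\<close> dominates
      each single operator norm, so the smallness condition becomes a pointwise estimate uniform in
      \<open>n\<close>.\<close>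
    have near: "nw (Mop m n f - L n f) \<le> ?e * ns f" if "f \<in> Bs" for n f
    proof (rule op_norm_le_imp_bound[OF subS ns nw _ _ _ that])
      show "Mop m n f - L n f \<in> Bw" if "f \<in> Bs" for f
        using that M_Bs[OF m] L_Bs \<open>Bs \<subseteq> Bw\<close> subW by (meson subsetD subspace_diff)
      show "Mop m n (c *\<^sub>R f) - L n (c *\<^sub>R f) = c *\<^sub>R (Mop m n f - L n f)" if "f \<in> Bs" for c f
        using that endo_M[OF m, of n] endo_L[of n] \<open>Bs \<subseteq> Bw\<close>
        unfolding endo_on_def by (metis scaleR_diff_right subsetD)
      have "op_norm Bs ns nw (\<lambda>f. Mop m n f - L n f) \<le> \<epsilon> m"
        unfolding \<epsilon>_def by (rule SUP_upper) simp
      then show "op_norm Bs ns nw (\<lambda>f. Mop m n f - L n f) \<le> ereal ?e"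
        using eps by (rule order_trans)
    qed
    let ?y = "seq_comp (Mop m) j (j + int M - 1) g" and ?z = "seq_comp L j (j + int M - 1) g"
    have y: "?y \<in> Bs"
      using M_Bs[OF m] g_Bs by (rule seq_comp_invariant)
    have z: "?z \<in> Bs"
      using L_Bs g_Bs by (rule seq_comp_invariant)
    \<comment> \<open>Here \<open>Mop m\<close> is the sequence that propagates the error and
      \<open>L\<close> the one whose orbit must be strongly bounded, by
      \<open>?K * ns g\<close>.\<close>
    have "nw (?y - ?z) \<le> real M * (?e * (?K * ns g))"
      by (rule seq_comp_perturbation[OF subW nw \<open>Bs \<subseteq> Bw\<close> endo_M[OF m] endo_L L_Bs
            Mop_weak[OF m] near L_bound[OF g_Bs] e g_Bs])
    moreover have "?y = ?z + (?y - ?z)"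
      by simp
    then have "nw ?y \<le> nw ?z + nw (?y - ?z)"
      using nw y z \<open>Bs \<subseteq> Bw\<close> subspace_diff[OF subW] unfolding norm_on_def by (metis subsetD)
    \<comment> \<open>Zero total mass of \<open>g\<close> enters the block estimate here.\<close>
    moreover have "nw ?z \<le> (1 - lam1) / (10 * B) * ns g"
      using g by (rule M_L)
    ultimately have "nw ?y \<le> (1 - lam1) / (10 * B) * ns g + real M * (?e * (?K * ns g))"
      by linarith
    \<comment> \<open>The factor \<open>B * ?a\<close> is the weight of the weak norm in the
      iterated Lasota-Yorke inequality; it turns \<open>(1 - lam1) / (10 * B)\<close> into exactly
      1/10.\<close>
    then have "B * ?a * nw ?y \<le> B * ?a * ((1 - lam1) / (10 * B) * ns g + real M * (?e * (?K * ns g)))"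
      using Ba by (rule mult_left_mono)
    also have "\<dots> = B * ?a * ((1 - lam1) / (10 * B)) * ns g + B * ?a * real M * ?e * ?K * ns g"
      by (subst distrib_left) (simp only: mult.assoc)
    also have "B * ?a * ((1 - lam1) / (10 * B)) = 1 / 10"
      using B pos by simp
    also have "B * ?a * real M * ?e * ?K \<le> 7 / 10"
    proof -
      \<comment> \<open>The threshold \<open>?e\<close> has \<open>?a + B\<close> in its
        denominator, whereas the orbit bound is \<open>B * ?a + 1\<close>. Replacing 1 by the larger
        \<open>?a * ?a\<close> makes the factor \<open>?a + B\<close> appear.\<close>
      have "1 * 1 \<le> ?a * ?a"
        using pos by (intro mult_mono[OF a a]) auto
      then have "?K \<le> ?a * (?a + B)"
        unfolding distrib_left mult.commute[of B ?a] by linarith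
      then have "B * ?a * real M * ?e * ?K \<le> B * ?a * real M * ?e * (?a * (?a + B))"
        by (rule mult_left_mono) (intro mult_nonneg_nonneg[OF _ e] mult_nonneg_nonneg[OF Ba] of_nat_0_le_iff)
      also have "\<dots> = (7 / 10) * ((1 - lam1) * ?a)\<^sup>2"
      proof -
        have "?a + B \<noteq> 0" "real M \<noteq> 0" "B \<noteq> 0"
          using a B M by linarith+
        \<comment> \<open>\<open>x\<close> stands for \<open>?a\<close> and \<open>l\<close> for
          \<open>1 - lam1\<close>. The square in \<open>?e\<close> meets the two factors
          \<open>?a\<close>, and their product is 1, which leaves 7/10.\<close>
        moreover have "B * x * N * (7 * l\<^sup>2 / (10 * N * B * s)) * (x * s) = (7 / 10) * (l * x)\<^sup>2"
          if "s \<noteq> 0" "N \<noteq> 0" "B \<noteq> 0" for x N l s :: real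
          using that by (simp add: power2_eq_square)
        ultimately show ?thesis
          by blast
      qed
      finally show ?thesis
        using pos by simp
    qed
    finally have weak_part: "B * ?a * nw ?y \<le> 1 / 10 * ns g + 7 / 10 * ns g"
      using g_nonneg by (simp add: mult_right_mono)
    \<comment> \<open>The uniform bound \<open>?K\<close> for the first half block cancels against
      the \<open>?K\<close> in \<open>M_lam1\<close>.\<close>
    have "lam1 ^ M * ns ?y \<le> 1 / (10 * ?K) * (?K * ns g)"
      using M_lam1 M_bound[OF m g_Bs] nonneg_s[OF y] K by (intro mult_mono) auto
    moreover have cancel: "1 / (10 * k) * (k * t) = 1 / 10 * t" if "0 < k" for k t :: real
      using that by simp
    ultimately have strong_part: "lam1 ^ M * ns ?y \<le> 1 / 10 * ns g"
      by (simp only: cancel[OF K])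
    \<comment> \<open>The inequality is applied to the second half only, started from
      \<open>?y\<close> at time \<open>j + int M\<close>. The contributions add up to 1/10 + 1/10 +
      7/10 = 9/10.\<close>
    have "ns (seq_comp (Mop m) j (j + int (M + M) - 1) g) \<le> lam1 ^ M * ns ?y + B / (1 - lam1) * nw ?y"
      unfolding seq_comp_add using m y by (rule M_LY)
    also have "B / (1 - lam1) = B * ?a"
      by simp
    also note add_mono[OF strong_part weak_part]
    finally show ?thesis
      unfolding mult_2 by simp
  qed
  \<comment> \<open>Both constants are built from \<open>B\<close>, \<open>lam1\<close> and
    \<open>M\<close> alone, which makes them independent of \<open>m\<close>.\<close>
  have decay: "ns (seq_comp (Mop m) j (j + int n - 1) g)
      \<le> ?K / (9 / 10) * root (2 * M) (9 / 10) ^ n * ns g"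
    if "m \<ge> 1" "\<epsilon> m \<le> ereal ?e" "g \<in> ?Z" for m j n g
    by (rule seq_comp_block_decay[where V = ?Z])
      (use that M_Z block M_bound nonneg_s K M in \<open>auto simp: ZD\<close>)
  have "0 < ?K / (9 / 10)"
    using K by (rule divide_pos_pos) simp
  moreover have "0 < root (2 * M) (9 / 10)" "root (2 * M) (9 / 10) < 1"
    using M by auto
  ultimately show ?thesis
    using block decay by (intro conjI exI[of _ "?K / (9 / 10)"] exI[of _ "root (2 * M) (9 / 10)"]) auto
qed

end
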